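(* Let $\mathbb{F}$ be a field and let $f \in \mathbb{F}[x_1,\ldots,x_n]$ be homogeneous of degree $d$. If $f$ can be represented using $\overline{\Sigma^{[k]}\Pi\Sigma}$, then $f$ can be represented by $\overline{\Sigma^{[k]}\mathrm{Sym}}$.
   Context: Let $\epsilon$ be a new variable and $\mathbb{F}(\epsilon)$ the field of rational functions. For $P \in \mathbb{F}(\epsilon)[x_1,\ldots,x_n]$ and $f \in \mathbb{F}[x_1,\ldots,x_n]$ write $P \simeq f$ if $P = \epsilon^N f + \epsilon^{N+1} Q$ for some integer $N \ge 0$ and some $Q \in \mathbb{F}[x_1,\ldots,x_n,\epsilon]$. $f$ is represented using $\overline{\Sigma^{[k]}\Pi\Sigma}$ if there are $c_1,\ldots,c_k \in \mathbb{F}(\epsilon)$ and affine polynomials (total degree at most $1$) $f_j^{(i)} \in \mathbb{F}(\epsilon)[x_1,\ldots,x_n]$, $1 \le i \le k$, $1 \le j \le m_i$, such that $\sum_{i=1}^k c_i \prod_{j=1}^{m_i} f_j^{(i)} \simeq f$. A homogeneous polynomial $f$ of degree $d$ is represented by $\overline{\Sigma^{[k]}\mathrm{Sym}}$ if there are $c_1,\ldots,c_k \in \mathbb{F}(\epsilon)$ and linear (homogeneous, constant-free) $L_j^{(i)} \in \mathbb{F}(\epsilon)[x_1,\ldots,x_n]$, $1 \le i \le k$, $1 \le j \le m_i$, such that $\sum_{i=1}^k c_i\, e_d^{m_i}(L_1^{(i)},\ldots,L_{m_i}^{(i)}) \simeq f$, where $e_d^m(y_1,\ldots,y_m) = \sum_{S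 \subseteq [m],\, |S|=d} \prod_{i\in S} y_i$. *)

theory Defs
  imports "HOL-Library.Poly_Mapping" "HOL-Computational_Algebra.Polynomial_Factorial"
begin

text \<open>
  A monomial is a finitely supported exponent vector, and a polynomial over \<open>'a\<close> is a finitely
  supported map from monomials to coefficients, with the convolution product of
  \<^theory>\<open>HOL-Library.Poly_Mapping\<close>.  The variables are indexed by \<^typ>\<open>nat\<close>; the ring
  $R[x_1,\ldots,x_n]$ is the set \<open>mpolys n\<close>, in which only the indices \<open>{1..n}\<close> occur.
\<close>

type_synonym monomial = "nat \<Rightarrow>\<^sub>0 nat"

type_synonym 'a mpoly = "monomial \<Rightarrow>\<^sub>0 'a"

definition mpolys :: "nat \<Rightarrow> 'a::zero mpoly set" where
  "mpolys n = {p. \<forall>\<alpha>\<in>Poly_Mapping.keys p. Poly_Mapping.keys \<alpha> \<subseteq> {1..n}}"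

definition mdeg :: "monomial \<Rightarrow> nat" where
  "mdeg \<alpha> = (\<Sum>v\<in>Poly_Mapping.keys \<alpha>. Poly_Mapping.lookup \<alpha> v)"

text \<open>The zero polynomial is homogeneous of every degree.\<close>

definition homogeneous :: "nat \<Rightarrow> 'a::zero mpoly \<Rightarrow> bool" where
  "homogeneous d p \<longleftrightarrow> (\<forall>\<alpha>\<in>Poly_Mapping.keys p. mdeg \<alpha> = d)"

definition affine_mpoly :: "'a::zero mpoly \<Rightarrow> bool" where
  "affine_mpoly p \<longleftrightarrow> (\<forall>\<alpha>\<in>Poly_Mapping.keys p. mdeg \<alpha> \<le> 1)"

definition linear_mpoly :: "'a::zero mpoly \<Rightarrow> bool" where
  "linear_mpoly p \<longleftrightarrow> homogeneous 1 p"

definition Const :: "'a::zero \<Rightarrow> 'a mpoly" where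
  "Const c = Poly_Mapping.single 0 c"

text \<open>
  The field $F(\epsilon)$ is the fraction field \<^typ>\<open>'a poly fract\<close> of $F[\epsilon]$.
  Elements of $F[x_1,\ldots,x_n,\epsilon]$ are represented as polynomials in the \<open>x\<close>-variables
  over $F[\epsilon]$, i.e. as elements of type \<^typ>\<open>'a poly mpoly\<close>.  Both rings are embedded
  coefficientwise into the polynomials over $F(\epsilon)$.
\<close>

definition eps :: "'a::field poly fract" where
  "eps = to_fract [:0, 1:]"

definition embed :: "'a::field mpoly \<Rightarrow> 'a poly fract mpoly" where
  "embed = Poly_Mapping.map (\<lambda>c. to_fract [:c:])"

definition embed_eps :: "'a::field poly mpoly \<Rightarrow> 'a poly fract mpoly" where
  "embed_eps = Poly_Mapping.map to_fract"

definition approximates :: "nat \<Rightarrow> 'a::field poly fract mpoly \<Rightarrow> 'a mpoly \<Rightarrow> bool" where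
  "approximates n P f \<longleftrightarrow>
     (\<exists>N::nat. \<exists>Q\<in>mpolys n.
        P = Const (eps ^ N) * embed f + Const (eps ^ (N + 1)) * embed_eps Q)"

definition esym :: "nat \<Rightarrow> nat \<Rightarrow> (nat \<Rightarrow> 'b::comm_semiring_1) \<Rightarrow> 'b" where
  "esym d m y = (\<Sum>S | S \<subseteq> {1..m} \<and> card S = d. \<Prod>j\<in>S. y j)"

definition border_SPS :: "nat \<Rightarrow> nat \<Rightarrow> 'a::field mpoly \<Rightarrow> bool" where
  "border_SPS n k f \<longleftrightarrow>
     (\<exists>(c :: nat \<Rightarrow> 'a poly fract) (m :: nat \<Rightarrow> nat) (A :: nat \<Rightarrow> nat \<Rightarrow> 'a poly fract mpoly).
        (\<forall>i\<in>{1..k}. \<forall>j\<in>{1..m i}. A i j \<in> mpolys n \<and> affine_mpoly (A i j)) \<and>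
        approximates n (\<Sum>i=1..k. Const (c i) * (\<Prod>j=1..m i. A i j)) f)"

definition border_SSym :: "nat \<Rightarrow> nat \<Rightarrow> nat \<Rightarrow> 'a::field mpoly \<Rightarrow> bool" where
  "border_SSym n k d f \<longleftrightarrow>
     (\<exists>(c :: nat \<Rightarrow> 'a poly fract) (m :: nat \<Rightarrow> nat) (L :: nat \<Rightarrow> nat \<Rightarrow> 'a poly fract mpoly).
        (\<forall>i\<in>{1..k}. \<forall>j\<in>{1..m i}. L i j \<in> mpolys n \<and> linear_mpoly (L i j)) \<and>
        approximates n (\<Sum>i=1..k. Const (c i) * esym d (m i) (L i)) f)"

end

theory Submission
  imports Defs
begin

text \<open>
  If every affine form $A_{ij} = a_{ij} + \ell_{ij}$ has constant term $a_{ij} \neq 0$, then the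
  degree $d$ part of $c_i\prod_j A_{ij}$ is
  $c_i \prod_j a_{ij} \cdot e_d(\ell_{i1}/a_{i1}, \ell_{i2}/a_{i2}, \ldots)$, and taking degree
  $d$ parts does not affect the approximation of the homogeneous $f$.  Vanishing constant terms are
  replaced by $\delta = \epsilon^{N+1} D$ with $D \in F[\epsilon]$ a common denominator of all
  expressions involved.  The error of this replacement lies in $\epsilon^{N+1} F[x,\epsilon]$.
  A mere power of $\epsilon$ would not do, as $F[x,\epsilon]$ does not contain denominators such
  as $1/(1+\epsilon)$.
\<close>

subsection \<open>Degrees and homogeneous components\<close>

text \<open>Exponents outside the support vanish, so two monomials can be summed over one common
  index set; this makes additivity of the degree immediate.\<close>

lemma mdeg_eq_sum:
  assumes "finite K" "Poly_Mapping.keys \<alpha> \<subseteq> K"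
  shows "mdeg \<alpha> = (\<Sum>v\<in>K. Poly_Mapping.lookup \<alpha> v)"
  unfolding mdeg_def using assms
  by (intro sum.mono_neutral_left) (auto simp: in_keys_iff)

lemma mdeg_add: "mdeg (\<alpha> + \<beta>) = mdeg \<alpha> + mdeg \<beta>"
proof -
  let ?K = "Poly_Mapping.keys \<alpha> \<union> Poly_Mapping.keys \<beta>"
  have "mdeg (\<alpha> + \<beta>) = (\<Sum>v\<in>?K. Poly_Mapping.lookup (\<alpha> + \<beta>) v)"
    by (rule mdeg_eq_sum) (use Poly_Mapping.keys_add[of \<alpha> \<beta>] in auto)
  also have "\<dots> = (\<Sum>v\<in>?K. Poly_Mapping.lookup \<alpha> v) + (\<Sum>v\<in>?K. Poly_Mapping.lookup \<beta> v)"
    by (simp add: lookup_add sum.distrib)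
  also have "\<dots> = mdeg \<alpha> + mdeg \<beta>"
    by (simp add: mdeg_eq_sum[of ?K])
  finally show ?thesis .
qed

lemma mdeg_0 [simp]: "mdeg 0 = 0"
  by (simp add: mdeg_def)

lemma mdeg_eq_0_iff: "mdeg \<alpha> = 0 \<longleftrightarrow> \<alpha> = 0"
  by (auto simp: mdeg_def in_keys_iff intro!: poly_mapping_eqI)

lemma homogeneous_one: "homogeneous 0 (1 :: 'a::comm_semiring_1 mpoly)"
  by (simp add: homogeneous_def)

lemma homogeneous_mult:
  fixes p q :: "'a::comm_semiring_1 mpoly"
  assumes "homogeneous d p" "homogeneous e q"
  shows "homogeneous (d + e) (p * q)"
  using assms Poly_Mapping.keys_mult[of p q] unfolding homogeneous_def
  by (fastforce simp: mdeg_add)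

lemma homogeneous_prod_linear:
  fixes L :: "'b \<Rightarrow> 'a::comm_semiring_1 mpoly"
  assumes "finite S" "\<And>j. j \<in> S \<Longrightarrow> linear_mpoly (L j)"
  shows "homogeneous (card S) (\<Prod>j\<in>S. L j)"
  using assms
proof (induction S rule: finite_induct)
  case (insert j S)
  then show ?case
    using homogeneous_mult[of 1 "L j" "card S" "prod L S"] by (simp add: linear_mpoly_def)
qed (simp add: homogeneous_one)

lift_definition hom_part :: "nat \<Rightarrow> 'a::zero mpoly \<Rightarrow> 'a mpoly" is
  "\<lambda>d p \<alpha>. p \<alpha> when mdeg \<alpha> = d"
  by (rule finite_subset) auto

lemma lookup_hom_part:
  "Poly_Mapping.lookup (hom_part d p) \<alpha> = (Poly_Mapping.lookup p \<alpha> when mdeg \<alpha> = d)"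
  by transfer rule

lemma lookup_Const_mult:
  "Poly_Mapping.lookup (Const c * p) \<alpha> = c * Poly_Mapping.lookup p \<alpha>"
  for c :: "'a::semiring_0"
  unfolding Const_def mult_map_scale_conv_mult[symmetric]
  by (auto simp: Poly_Mapping.map.rep_eq when_def)

lemma Const_mult: "Const (a * b) = Const a * Const b" for a :: "'a::semiring_0"
  by (simp add: Const_def mult_single)

lemma Const_1 [simp]: "Const 1 = 1"
  by (simp add: Const_def)

lemma Const_prod: "Const (\<Prod>j\<in>S. a j) = (\<Prod>j\<in>S. Const (a j))" for a :: "'b \<Rightarrow> 'a::comm_semiring_1"
  by (induction S rule: infinite_finite_induct) (simp_all add: Const_mult)

lemma hom_part_add: "hom_part d (p + q) = hom_part d p + hom_part d q" for p :: "'a::monoid_add mpoly"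
  by (rule poly_mapping_eqI) (simp add: lookup_hom_part lookup_add when_def)

lemma hom_part_sum: "hom_part d (\<Sum>i\<in>I. p i) = (\<Sum>i\<in>I. hom_part d (p i))"
  by (rule poly_mapping_eqI) (simp add: lookup_hom_part lookup_sum when_def)

lemma hom_part_Const_mult: "hom_part d (Const c * p) = Const c * hom_part d p" for c :: "'a::semiring_0"
  by (rule poly_mapping_eqI) (simp add: lookup_hom_part lookup_Const_mult when_def)

lemma hom_part_homogeneous:
  assumes "homogeneous e p"
  shows "hom_part d p = (if d = e then p else 0)"
  using assms by (intro poly_mapping_eqI) (auto simp: homogeneous_def lookup_hom_part when_def in_keys_iff)

lemma homogeneous_hom_part: "homogeneous d (hom_part d p)"
  by (auto simp: homogeneous_def in_keys_iff lookup_hom_part)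

lemma affine_decomposition:
  fixes A :: "'a::comm_monoid_add mpoly"
  assumes "affine_mpoly A"
  shows "A = Const (Poly_Mapping.lookup A 0) + hom_part 1 A"
proof (rule poly_mapping_eqI)
  fix \<alpha>
  consider "\<alpha> = 0" | "mdeg \<alpha> = 1" | "mdeg \<alpha> > 1"
    using mdeg_eq_0_iff[of \<alpha>] by linarith
  then show "Poly_Mapping.lookup A \<alpha> =
      Poly_Mapping.lookup (Const (Poly_Mapping.lookup A 0) + hom_part 1 A) \<alpha>"
    using assms
    by cases (auto simp: affine_mpoly_def Const_def lookup_add lookup_single lookup_hom_part when_def
        in_keys_iff not_le[symmetric])
qed

text \<open>Expanding the product gives one term per subset \<open>S\<close> of the factors, the
  product of the \<open>L j\<close> over \<open>S\<close>. That term is homogeneous of degree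
  \<open>card S\<close>, so the degree \<open>d\<close> part keeps exactly the subsets of size
  \<open>d\<close>.\<close>

lemma hom_part_prod_one_plus:
  fixes L :: "nat \<Rightarrow> 'a::comm_semiring_1 mpoly"
  assumes "\<And>j. j \<in> {1..m} \<Longrightarrow> linear_mpoly (L j)"
  shows "hom_part d (\<Prod>j=1..m. 1 + L j) = esym d m L"
proof -
  have "(\<Prod>j=1..m. 1 + L j) = (\<Prod>j=1..m. L j + 1)"
    by (simp add: add.commute)
  also have "\<dots> = (\<Sum>S\<in>Pow {1..m}. \<Prod>j\<in>S. L j)"
    by (subst prod_add) simp_all
  finally have "hom_part d (\<Prod>j=1..m. 1 + L j) = (\<Sum>S\<in>Pow {1..m}. hom_part d (\<Prod>j\<in>S. L j))"
    by (simp add: hom_part_sum)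
  also have "\<dots> = (\<Sum>S\<in>Pow {1..m}. if d = card S then \<Prod>j\<in>S. L j else 0)"
  proof (rule sum.cong[OF refl])
    fix S assume "S \<in> Pow {1..m}"
    then have "finite S" "\<And>j. j \<in> S \<Longrightarrow> linear_mpoly (L j)"
      using assms by (auto intro: finite_subset)
    from homogeneous_prod_linear[OF this]
    show "hom_part d (\<Prod>j\<in>S. L j) = (if d = card S then \<Prod>j\<in>S. L j else 0)"
      by (rule hom_part_homogeneous)
  qed
  also have "\<dots> = esym d m L"
    unfolding esym_def by (intro sum.mono_neutral_cong_right) auto
  finally show ?thesis .
qed

subsection \<open>Polynomials with coefficients in the polynomial ring\<close>

lemma mpolys_zero: "0 \<in> mpolys n"
  and mpolys_one: "(1 :: 'a::comm_semiring_1 mpoly) \<in> mpolys n"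
  and mpolys_Const: "Const c \<in> mpolys n"
  by (auto simp: mpolys_def Const_def)

lemma mpolys_add: "p \<in> mpolys n \<Longrightarrow> q \<in> mpolys n \<Longrightarrow> p + q \<in> mpolys n"
  for p :: "'a::comm_semiring_1 mpoly"
  unfolding mpolys_def using Poly_Mapping.keys_add[of p q] by blast

lemma mpolys_mult:
  fixes p q :: "'a::comm_semiring_1 mpoly"
  assumes "p \<in> mpolys n" "q \<in> mpolys n"
  shows "p * q \<in> mpolys n"
  unfolding mpolys_def
proof (intro CollectI ballI)
  fix \<alpha> assume "\<alpha> \<in> Poly_Mapping.keys (p * q)"
  then obtain a b where "\<alpha> = a + b" "a \<in> Poly_Mapping.keys p" "b \<in> Poly_Mapping.keys q"
    using Poly_Mapping.keys_mult[of p q] by blast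
  then show "Poly_Mapping.keys \<alpha> \<subseteq> {1..n}"
    using assms Poly_Mapping.keys_add[of a b] unfolding mpolys_def by blast
qed

lemma mpolys_hom_part: "p \<in> mpolys n \<Longrightarrow> hom_part d p \<in> mpolys n"
  by (auto simp: mpolys_def in_keys_iff lookup_hom_part)

text \<open>The copy of F[x, eps] inside F(eps)[x], described through coefficients. Closure
  properties then reduce to those of \<open>range to_fract\<close>, and no preimages under
  \<open>embed_eps\<close> have to be carried along.\<close>

definition integral_mpolys :: "nat \<Rightarrow> 'a::field poly fract mpoly set" where
  "integral_mpolys n = {p \<in> mpolys n. \<forall>\<alpha>. Poly_Mapping.lookup p \<alpha> \<in> range to_fract}"

lemma range_to_fract_closed:
  shows "0 \<in> range to_fract"
    and "x \<in> range to_fract \<Longrightarrow> y \<in> range to_fract \<Longrightarrow> x + y \<in> range to_fract"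
    and "x \<in> range to_fract \<Longrightarrow> y \<in> range to_fract \<Longrightarrow> x * y \<in> range to_fract"
  using rangeI[of to_fract 0] by (auto simp flip: to_fract_add to_fract_mult)

lemma sum_in_range_to_fract:
  "(\<And>x. x \<in> S \<Longrightarrow> g x \<in> range to_fract) \<Longrightarrow> (\<Sum>x\<in>S. g x) \<in> range to_fract"
  by (induction S rule: infinite_finite_induct) (simp_all add: range_to_fract_closed)

text \<open>The coefficients of a convolution product are given by \<open>Sum_any\<close>, so this
  serves closure under multiplication.\<close>

lemma Sum_any_in_range_to_fract:
  "(\<And>x. g x \<in> range to_fract) \<Longrightarrow> Sum_any g \<in> range to_fract"
  unfolding Sum_any.expand_set by (rule sum_in_range_to_fract)

lemma integral_mpolys_zero: "0 \<in> integral_mpolys n"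
  by (simp add: integral_mpolys_def mpolys_zero range_to_fract_closed(1))

lemma integral_mpolys_Const: "Const (to_fract c) \<in> integral_mpolys n"
  using mpolys_Const[of "to_fract c" n]
  by (auto simp: integral_mpolys_def Const_def lookup_single when_def range_to_fract_closed(1))

lemma integral_mpolys_add:
  "p \<in> integral_mpolys n \<Longrightarrow> q \<in> integral_mpolys n \<Longrightarrow> p + q \<in> integral_mpolys n"
  by (simp add: integral_mpolys_def mpolys_add lookup_add range_to_fract_closed(2))

lemma integral_mpolys_mult:
  "p \<in> integral_mpolys n \<Longrightarrow> q \<in> integral_mpolys n \<Longrightarrow> p * q \<in> integral_mpolys n"
  by (auto simp: integral_mpolys_def mpolys_mult lookup_mult when_def
      intro!: Sum_any_in_range_to_fract range_to_fract_closed)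

lemma integral_mpolys_hom_part: "p \<in> integral_mpolys n \<Longrightarrow> hom_part d p \<in> integral_mpolys n"
  by (auto simp: integral_mpolys_def mpolys_hom_part lookup_hom_part when_def
      range_to_fract_closed(1))

lemma lookup_embed_eps:
  "Poly_Mapping.lookup (embed_eps Q) \<alpha> = to_fract (Poly_Mapping.lookup Q \<alpha>)"
  by (auto simp: embed_eps_def Poly_Mapping.map.rep_eq when_def)

lemma lookup_embed:
  "Poly_Mapping.lookup (embed f) \<alpha> = to_fract [:Poly_Mapping.lookup f \<alpha>:]"
  by (auto simp: embed_def Poly_Mapping.map.rep_eq when_def)

lemma integral_mpolys_eq: "integral_mpolys n = embed_eps ` mpolys n"
proof (intro equalityI subsetI)
  fix p :: "'a poly fract mpoly" assume p: "p \<in> integral_mpolys n"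
  define Q where "Q = Poly_Mapping.map (inv to_fract) p"
  \<comment> \<open>\<open>Poly_Mapping.map\<close> keeps zero coefficients at zero, so the formula
    for the coefficients of \<open>Q\<close> requires the inverse to fix zero.\<close>
  have inv_0: "inv to_fract 0 = (0 :: 'a poly)"
    by (metis inj_def inv_f_f to_fract_0 to_fract_eq_iff)
  have lookup_Q: "Poly_Mapping.lookup Q \<alpha> = inv to_fract (Poly_Mapping.lookup p \<alpha>)" for \<alpha>
    by (auto simp: Q_def Poly_Mapping.map.rep_eq when_def inv_0)
  have "Q \<in> mpolys n"
    using p by (auto simp: mpolys_def integral_mpolys_def in_keys_iff lookup_Q inv_0)
  moreover have "p = embed_eps Q"
    using p by (intro poly_mapping_eqI) (simp add: lookup_embed_eps lookup_Q integral_mpolys_def f_inv_into_f)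
  ultimately show "p \<in> embed_eps ` mpolys n" by blast
next
  fix p :: "'a poly fract mpoly" assume "p \<in> embed_eps ` mpolys n"
  then show "p \<in> integral_mpolys n"
    by (auto simp: integral_mpolys_def mpolys_def in_keys_iff lookup_embed_eps)
qed

lemma approximates_iff:
  "approximates n P f \<longleftrightarrow>
    (\<exists>N. \<exists>Q\<in>integral_mpolys n. P = Const (eps ^ N) * embed f + Const (eps ^ (N + 1)) * Q)"
  unfolding approximates_def integral_mpolys_eq by blast

text \<open>Taking the degree \<open>d\<close> part is additive, commutes with the powers of
  \<open>eps\<close>, fixes \<open>embed f\<close> and maps integral polynomials to integral ones.
  The same exponent \<open>N\<close> works, with the error \<open>Q\<close> replaced by its degree
  \<open>d\<close> part.\<close>

lemma approximates_hom_part: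
  assumes "approximates n P f" "homogeneous d f"
  shows "approximates n (hom_part d P) f"
proof -
  have "homogeneous d (embed f)"
    using assms(2) by (auto simp: homogeneous_def in_keys_iff lookup_embed)
  then have "hom_part d (embed f) = embed f"
    by (simp add: hom_part_homogeneous)
  with assms(1) show ?thesis
    unfolding approximates_iff
    by (metis hom_part_add hom_part_Const_mult integral_mpolys_hom_part)
qed

text \<open>Only finitely many coefficients are nonzero. Their denominators are multiplied up one
  monomial at a time: the new factor \<open>b\<close> clears the coefficient at
  \<open>\<beta>\<close>, and the earlier coefficients stay integral under multiplication by
  \<open>b\<close>.\<close>

lemma common_denominator:
  fixes p :: "'a::field poly fract mpoly"
  assumes "p \<in> mpolys n"
  obtains D where "D \<noteq> 0" "Const (to_fract D) * p \<in> integral_mpolys n"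
proof -
  have "\<exists>D. D \<noteq> 0 \<and> (\<forall>\<alpha>\<in>K. to_fract D * Poly_Mapping.lookup p \<alpha> \<in> range to_fract)"
    if "finite K" for K
    using that
  proof (induction K rule: finite_induct)
    case (insert \<beta> K)
    then obtain D where D: "D \<noteq> 0" "\<And>\<alpha>. \<alpha> \<in> K \<Longrightarrow> to_fract D * Poly_Mapping.lookup p \<alpha> \<in> range to_fract"
      by blast
    obtain a b where ab: "Poly_Mapping.lookup p \<beta> = to_fract a / to_fract b" "b \<noteq> 0"
      by (metis Fract_cases Fract_conv_to_fract)
    have "to_fract (b * D) * Poly_Mapping.lookup p \<alpha> \<in> range to_fract" if "\<alpha> \<in> insert \<beta> K" for \<alpha>
    proof (cases "\<alpha> = \<beta>")
      case True
      then have "to_fract (b * D) * Poly_Mapping.lookup p \<alpha> = to_fract (D * a)"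
        using ab by simp
      then show ?thesis by (metis rangeI)
    next
      case False
      then show ?thesis
        using D(2)[of \<alpha>] that range_to_fract_closed(3)[of "to_fract b"] by (simp add: mult.assoc)
    qed
    then show ?case using D(1) ab(2) by (intro exI[of _ "b * D"]) auto
  qed (auto intro: exI[of _ 1])
  from this[of "Poly_Mapping.keys p"] obtain D where D: "D \<noteq> 0"
    "\<And>\<alpha>. \<alpha> \<in> Poly_Mapping.keys p \<Longrightarrow> to_fract D * Poly_Mapping.lookup p \<alpha> \<in> range to_fract"
    by auto
  have "to_fract D * Poly_Mapping.lookup p \<alpha> \<in> range to_fract" for \<alpha>
    using D(2)[of \<alpha>] range_to_fract_closed(1) by (cases "Poly_Mapping.lookup p \<alpha> = 0") (auto simp: in_keys_iff)
  then have "Const (to_fract D) * p \<in> integral_mpolys n"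
    using assms by (simp add: integral_mpolys_def mpolys_mult mpolys_Const lookup_Const_mult)
  with D(1) show ?thesis by (rule that)
qed

subsection \<open>Perturbing the constant terms\<close>

text \<open>The denominator \<open>D\<close> must not depend on \<open>\<delta>\<close>, so that \<open>\<delta>\<close> may be chosen as a multiple of it.\<close>

definition perturbable :: "nat \<Rightarrow> ('a::field poly \<Rightarrow> 'a poly fract mpoly) \<Rightarrow> bool" where
  "perturbable n G \<longleftrightarrow> G 0 \<in> mpolys n \<and>
    (\<exists>D. D \<noteq> 0 \<and> (\<forall>\<delta>. \<exists>Q\<in>integral_mpolys n.
      Const (to_fract D) * (G \<delta> - G 0) = Const (to_fract \<delta>) * Q))"

lemma perturbable_const: "p \<in> mpolys n \<Longrightarrow> perturbable n (\<lambda>_. p)"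
  unfolding perturbable_def
  by (auto intro!: exI[of _ 1] bexI[of _ 0] simp: integral_mpolys_zero)

text \<open>The value at 0 is the zero polynomial, so the difference is \<delta> itself and both
  \<open>D\<close> and \<open>Q\<close> can be 1.\<close>

lemma perturbable_Const_to_fract: "perturbable n (\<lambda>\<delta>. Const (to_fract \<delta>))"
  unfolding perturbable_def
  using integral_mpolys_Const[of 1 n]
  by (auto intro!: exI[of _ 1] bexI[of _ 1] simp: mpolys_Const) (simp add: Const_def)

lemma perturbable_add:
  assumes "perturbable n G" "perturbable n H"
  shows "perturbable n (\<lambda>\<delta>. G \<delta> + H \<delta>)"
proof -
  let ?C = "\<lambda>c. Const (to_fract c) :: 'a poly fract mpoly"
  obtain D Q where D: "D \<noteq> 0"
    "\<And>\<delta>. Q \<delta> \<in> integral_mpolys n" "\<And>\<delta>. ?C D * (G \<delta> - G 0) = ?C \<delta> * Q \<delta>"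
    using assms(1) unfolding perturbable_def by metis
  obtain E R where E: "E \<noteq> 0"
    "\<And>\<delta>. R \<delta> \<in> integral_mpolys n" "\<And>\<delta>. ?C E * (H \<delta> - H 0) = ?C \<delta> * R \<delta>"
    using assms(2) unfolding perturbable_def by metis
  have "?C (D * E) * (G \<delta> + H \<delta> - (G 0 + H 0)) = ?C \<delta> * (?C E * Q \<delta> + ?C D * R \<delta>)" for \<delta>
  proof -
    have "?C (D * E) * (G \<delta> + H \<delta> - (G 0 + H 0)) =
        ?C E * (?C D * (G \<delta> - G 0)) + ?C D * (?C E * (H \<delta> - H 0))"
      by (simp add: Const_mult algebra_simps)
    then show ?thesis unfolding D(3) E(3) by (simp add: algebra_simps)
  qed
  moreover have "?C E * Q \<delta> + ?C D * R \<delta> \<in> integral_mpolys n" for \<delta>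
    by (intro integral_mpolys_add integral_mpolys_mult integral_mpolys_Const D(2) E(2))
  moreover have "D * E \<noteq> 0" using D(1) E(1) by simp
  ultimately show ?thesis
    using assms unfolding perturbable_def by (blast intro: mpolys_add)
qed

text \<open>With \<open>g = G \<delta> - G 0\<close> and \<open>h = H \<delta> - H 0\<close>, the
  difference of the products is \<open>g * h + G 0 * h + H 0 * g\<close>, and each term contains a
  factor that is a multiple of \<delta> up to a denominator.\<close>

lemma perturbable_mult:
  assumes "perturbable n G" "perturbable n H"
  shows "perturbable n (\<lambda>\<delta>. G \<delta> * H \<delta>)"
proof -
  let ?C = "\<lambda>c. Const (to_fract c) :: 'a poly fract mpoly"
  obtain D Q where D: "D \<noteq> 0"
    "\<And>\<delta>. Q \<delta> \<in> integral_mpolys n" "\<And>\<delta>. ?C D * (G \<delta> - G 0) = ?C \<delta> * Q \<delta>"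
    using assms(1) unfolding perturbable_def by metis
  obtain E R where E: "E \<noteq> 0"
    "\<And>\<delta>. R \<delta> \<in> integral_mpolys n" "\<And>\<delta>. ?C E * (H \<delta> - H 0) = ?C \<delta> * R \<delta>"
    using assms(2) unfolding perturbable_def by metis
  \<comment> \<open>\<open>G 0\<close> and \<open>H 0\<close> may have coefficients outside F[eps],
    so they need denominators of their own. These do not involve \<delta>.\<close>
  obtain B where B: "B \<noteq> 0" "?C B * G 0 \<in> integral_mpolys n"
    using assms(1) common_denominator unfolding perturbable_def by metis
  obtain B' where B': "B' \<noteq> 0" "?C B' * H 0 \<in> integral_mpolys n"
    using assms(2) common_denominator unfolding perturbable_def by metis
  let ?D = "D * E * B * B'"
  \<comment> \<open>The three summands come from \<open>g * h\<close>, \<open>G 0 * h\<close> and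
    \<open>H 0 * g\<close> after one factor \<delta> is taken out; the first was divisible by the
    square of \<delta> and retains one factor. The outer constants are the parts of
    \<open>?D\<close> that the respective term does not use up.\<close>
  let ?S = "\<lambda>\<delta>. ?C (B * B') * (?C \<delta> * Q \<delta> * R \<delta>) + ?C (D * B') * ((?C B * G 0) * R \<delta>)
    + ?C (E * B) * ((?C B' * H 0) * Q \<delta>)"
  have "?C ?D * (G \<delta> * H \<delta> - G 0 * H 0) = ?C \<delta> * ?S \<delta>" for \<delta>
  proof -
    have "?C ?D * (G \<delta> * H \<delta> - G 0 * H 0) =
        ?C (B * B') * ((?C D * (G \<delta> - G 0)) * (?C E * (H \<delta> - H 0)))
        + ?C (D * B') * ((?C B * G 0) * (?C E * (H \<delta> - H 0)))
        + ?C (E * B) * ((?C B' * H 0) * (?C D * (G \<delta> - G 0)))"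
      by (simp add: Const_mult algebra_simps)
    then show ?thesis unfolding D(3) E(3) by (simp add: algebra_simps)
  qed
  moreover have "?S \<delta> \<in> integral_mpolys n" for \<delta>
    by (intro integral_mpolys_add integral_mpolys_mult[OF integral_mpolys_Const]
        integral_mpolys_mult[OF B(2)] integral_mpolys_mult[OF B'(2)] integral_mpolys_mult[OF _ E(2)] D(2) E(2))
  moreover have "?D \<noteq> 0" using D(1) E(1) B(1) B'(1) by simp
  ultimately show ?thesis
    using assms unfolding perturbable_def by (blast intro: mpolys_mult)
qed

lemma perturbable_sum:
  "(\<And>i. i \<in> I \<Longrightarrow> perturbable n (G i)) \<Longrightarrow> perturbable n (\<lambda>\<delta>. \<Sum>i\<in>I. G i \<delta>)"
  by (induction I rule: infinite_finite_induct)
    (simp_all add: perturbable_add perturbable_const mpolys_zero)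

lemma perturbable_prod:
  "(\<And>i. i \<in> I \<Longrightarrow> perturbable n (G i)) \<Longrightarrow> perturbable n (\<lambda>\<delta>. \<Prod>i\<in>I. G i \<delta>)"
  by (induction I rule: infinite_finite_induct)
    (simp_all add: perturbable_mult perturbable_const mpolys_one)

lemma perturbable_approximates:
  assumes "perturbable n G" "approximates n (G 0) f"
  obtains \<delta> where "\<delta> \<noteq> 0" "approximates n (G \<delta>) f"
proof -
  let ?C = "\<lambda>c. Const (to_fract c) :: 'a poly fract mpoly"
  obtain N Q where Q: "Q \<in> integral_mpolys n"
    "G 0 = Const (eps ^ N) * embed f + Const (eps ^ (N + 1)) * Q"
    using assms(2) unfolding approximates_iff by blast
  obtain D R where D: "D \<noteq> 0"
    "\<And>\<delta>. R \<delta> \<in> integral_mpolys n" "\<And>\<delta>. ?C D * (G \<delta> - G 0) = ?C \<delta> * R \<delta>"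
    using assms(1) unfolding perturbable_def by metis
  \<comment> \<open>The factor \<open>D\<close> cancels the denominator, and the power of
    \<open>eps\<close> moves the whole perturbation into the error term of order
    \<open>N + 1\<close>.\<close>
  define \<delta> where "\<delta> = D * [:0, 1:] ^ (N + 1)"
  have eps_power: "to_fract ([:0, 1:] ^ M) = eps ^ M" for M
    by (induction M) (simp_all add: eps_def del: mult_pCons_left)
  have "?C \<delta> = ?C D * Const (eps ^ (N + 1))"
    unfolding \<delta>_def to_fract_mult eps_power Const_mult ..
  then have "?C D * (G \<delta> - G 0) = ?C D * (Const (eps ^ (N + 1)) * R \<delta>)"
    using D(3)[of \<delta>] by (simp add: mult.assoc)
  \<comment> \<open>Cancellation of \<open>D\<close> happens in the coefficient field F(eps), by
    multiplying with its inverse.\<close>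
  then have "Const (inverse (to_fract D) * to_fract D) * (G \<delta> - G 0) =
      Const (inverse (to_fract D) * to_fract D) * (Const (eps ^ (N + 1)) * R \<delta>)"
    unfolding Const_mult mult.assoc by simp
  then have "G \<delta> - G 0 = Const (eps ^ (N + 1)) * R \<delta>"
    using D(1) by simp
  then have "G \<delta> = Const (eps ^ N) * embed f + Const (eps ^ (N + 1)) * (Q + R \<delta>)"
    using Q(2) by (simp add: algebra_simps)
  moreover have "Q + R \<delta> \<in> integral_mpolys n"
    using Q(1) D(2) by (rule integral_mpolys_add)
  moreover have "\<delta> \<noteq> 0" using D(1) by (simp add: \<delta>_def)
  ultimately show ?thesis using that unfolding approximates_iff by blast
qed

section \<open>From products of affine forms to elementary symmetric polynomials\<close>

text \<open>Taking the nonzero constant term out of each factor leaves \<open>1 + ?L j\<close> with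
  \<open>?L j\<close> linear, which reduces the claim to
  \<open>hom_part_prod_one_plus\<close>.\<close>

lemma hom_part_prod_affine:
  fixes A :: "nat \<Rightarrow> 'a::field mpoly"
  assumes "\<And>j. j \<in> {1..m} \<Longrightarrow> affine_mpoly (A j)"
    and "\<And>j. j \<in> {1..m} \<Longrightarrow> Poly_Mapping.lookup (A j) 0 \<noteq> 0"
  shows "hom_part d (\<Prod>j=1..m. A j) =
    Const (\<Prod>j=1..m. Poly_Mapping.lookup (A j) 0) *
    esym d m (\<lambda>j. Const (inverse (Poly_Mapping.lookup (A j) 0)) * hom_part 1 (A j))"
proof -
  let ?a = "\<lambda>j. Poly_Mapping.lookup (A j) 0"
  let ?L = "\<lambda>j. Const (inverse (?a j)) * hom_part 1 (A j)"
  have "A j = Const (?a j) * (1 + ?L j)" if "j \<in> {1..m}" for j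
  proof -
    have "Const (?a j) * ?L j = Const (?a j * inverse (?a j)) * hom_part 1 (A j)"
      unfolding Const_mult mult.assoc ..
    also have "\<dots> = hom_part 1 (A j)"
      using assms(2)[OF that] by simp
    finally have "Const (?a j) * (1 + ?L j) = Const (?a j) + hom_part 1 (A j)"
      by (simp only: distrib_left mult_1_right)
    then show ?thesis
      using affine_decomposition[OF assms(1)[OF that]] by argo
  qed
  then have "(\<Prod>j=1..m. A j) = Const (\<Prod>j=1..m. ?a j) * (\<Prod>j=1..m. 1 + ?L j)"
    by (simp add: Const_prod prod.distrib[symmetric])
  moreover have "linear_mpoly (?L j)" for j
    unfolding linear_mpoly_def by (metis hom_part_Const_mult homogeneous_hom_part)
  ultimately show ?thesis
    by (simp only: hom_part_Const_mult hom_part_prod_one_plus)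
qed

theorem theorem3p9:
  fixes f :: "'a::field mpoly" and n d k :: nat
  assumes "f \<in> mpolys n"
    and "homogeneous d f"
    and "border_SPS n k f"
  shows "border_SSym n k d f"
proof -
  obtain c m and A :: "nat \<Rightarrow> nat \<Rightarrow> 'a poly fract mpoly" where
    A: "\<And>i j. i \<in> {1..k} \<Longrightarrow> j \<in> {1..m i} \<Longrightarrow> A i j \<in> mpolys n \<and> affine_mpoly (A i j)"
    and f: "approximates n (\<Sum>i=1..k. Const (c i) * (\<Prod>j=1..m i. A i j)) f"
    using assms(3) unfolding border_SPS_def by blast
  \<comment> \<open>Only vanishing constant terms are changed. Hence \<open>B 0\<close> is
    \<open>A\<close>, while for nonzero \<delta> every constant term of \<open>B \<delta>\<close> is
    nonzero; the numbers of summands and factors stay the same.\<close>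
  define B where "B \<delta> i j =
    A i j + (if Poly_Mapping.lookup (A i j) 0 = 0 then Const (to_fract \<delta>) else 0)" for \<delta> i j
  define G where "G \<delta> = (\<Sum>i=1..k. Const (c i) * (\<Prod>j=1..m i. B \<delta> i j))" for \<delta>
  have "perturbable n (\<lambda>\<delta>. B \<delta> i j)" if "i \<in> {1..k}" "j \<in> {1..m i}" for i j
    unfolding B_def using A[OF that]
    by (cases "Poly_Mapping.lookup (A i j) 0 = 0")
      (auto intro!: perturbable_add perturbable_const perturbable_Const_to_fract)
  then have "perturbable n G"
    unfolding G_def
    by (intro perturbable_sum perturbable_mult perturbable_prod perturbable_const mpolys_Const)
  moreover have "B 0 = A" by (auto simp: B_def Const_def fun_eq_iff)
  then have "approximates n (G 0) f" using f by (simp add: G_def)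
  ultimately obtain \<delta> where "\<delta> \<noteq> 0" and G: "approximates n (G \<delta>) f"
    by (rule perturbable_approximates)
  have B: "B \<delta> i j \<in> mpolys n" "affine_mpoly (B \<delta> i j)" "Poly_Mapping.lookup (B \<delta> i j) 0 \<noteq> 0"
    if "i \<in> {1..k}" "j \<in> {1..m i}" for i j
    using A[OF that] \<open>\<delta> \<noteq> 0\<close> mpolys_Const[of "to_fract \<delta>" n]
    by (auto simp: B_def mpolys_add affine_mpoly_def Const_def in_keys_iff lookup_add
        lookup_single when_def split: if_splits)
  \<comment> \<open>The extracted constants are absorbed into the scalar of each summand, so
    \<open>k\<close> is preserved.\<close>
  define c' where "c' i = c i * (\<Prod>j=1..m i. Poly_Mapping.lookup (B \<delta> i j) 0)" for i
  define L where "L i j =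
    Const (inverse (Poly_Mapping.lookup (B \<delta> i j) 0)) * hom_part 1 (B \<delta> i j)" for i j
  have hom_G: "hom_part d (G \<delta>) = (\<Sum>i=1..k. Const (c' i) * esym d (m i) (L i))"
    unfolding G_def hom_part_sum hom_part_Const_mult c'_def L_def Const_mult mult.assoc
    by (intro sum.cong refl arg_cong2[where f = times] hom_part_prod_affine B)
  have "L i j \<in> mpolys n \<and> linear_mpoly (L i j)" if "i \<in> {1..k}" "j \<in> {1..m i}" for i j
    \<comment> \<open>Moving the scalar inside exhibits \<open>L i j\<close> as the degree 1 part of
      a polynomial, hence as linear.\<close>
    unfolding L_def linear_mpoly_def hom_part_Const_mult[symmetric]
    by (intro conjI homogeneous_hom_part mpolys_hom_part mpolys_mult mpolys_Const B that)
  then show ?thesis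
    using approximates_hom_part[OF G assms(2)] unfolding border_SSym_def hom_G
    by (intro exI[of _ c'] exI[of _ m] exI[of _ L]) simp
qed

end
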